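(* Let $\mathcal{I}$ be a meager ideal on $\omega$ and fix $f\in\mathrm{SL}(\mathcal{I})$. Then there exists $g\in\mathrm{SL}(\mathcal{I})$ such that $\|f-g\|=2$, where $\|\cdot\|$ is the dual norm on $\ell_\infty^{\,\prime}$.
   Context: $\omega$ is the set of nonnegative integers. An ideal on $\omega$ is a family $\mathcal{I}\subseteq\mathcal{P}(\omega)$ closed under finite unions and subsets, with $\omega\notin\mathcal{I}$ and containing all finite subsets of $\omega$. Identifying subsets of $\omega$ with their characteristic functions, ideals are regarded as subsets of the Cantor space $\{0,1\}^\omega$; an ideal is meager if it is a meager (first category) subset of $\{0,1\}^\omega$. $\ell_\infty$ is the Banach lattice of bounded real sequences with the supremum norm and pointwise order, $\ell_\infty^{\,\prime}$ its norm dual; $c$ is the space of convergent real sequences; $\bm{1}_A$ is the characteristic sequence of $A\subseteq\omega$. $\mathrm{SL}(\mathcal{I})$ is the set of linear functionals $f:\ell_\infty\to\mathbf{R}$ such that: (i) $f(x)\ge 0$ whenever $x\ge 0$; (ii) $f(x)=\lim x$ for all $x\in c$; (iii) $f(\bm{1}_A)=0$ for all $A\in\mathcal{I}$. (Such functionals are automatically continuous.) *)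

theory Defs
  imports "HOL-Analysis.Analysis"
begin

definition ideal_on_nat :: "nat set set \<Rightarrow> bool" where
  "ideal_on_nat I \<longleftrightarrow>
     (\<forall>A\<in>I. \<forall>B\<in>I. A \<union> B \<in> I) \<and>
     (\<forall>A\<in>I. \<forall>B. B \<subseteq> A \<longrightarrow> B \<in> I) \<and>
     UNIV \<notin> I \<and>
     (\<forall>A. finite A \<longrightarrow> A \<in> I)"

definition nowhere_dense :: "'a::topological_space set \<Rightarrow> bool" where
  "nowhere_dense S \<longleftrightarrow> interior (closure S) = {}"

definition meager :: "'a::topological_space set \<Rightarrow> bool" where
  "meager S \<longleftrightarrow> (\<exists>N :: nat \<Rightarrow> 'a set. (\<forall>n. nowhere_dense (N n)) \<and> S \<subseteq> (\<Union>n. N n))"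

text \<open>The Cantor space is the type \<^typ>\<open>nat \<Rightarrow> bool\<close>, whose \<^class>\<open>topological_space\<close>
  instance is the product topology with \<^typ>\<open>bool\<close> discrete.\<close>

definition char_fun :: "nat set \<Rightarrow> (nat \<Rightarrow> bool)" where
  "char_fun A = (\<lambda>n. n \<in> A)"

definition meager_ideal :: "nat set set \<Rightarrow> bool" where
  "meager_ideal I \<longleftrightarrow> ideal_on_nat I \<and> meager (char_fun ` I)"

text \<open>Since \<^typ>\<open>nat\<close> is discrete, every sequence is continuous, so the bounded continuous
  functions below are all the bounded real sequences; their norm is the supremum norm.\<close>

type_synonym linf = "nat \<Rightarrow>\<^sub>C real"

definition char_seq :: "nat set \<Rightarrow> linf" where
  "char_seq A = Bcontfun (indicator A)"

lemma apply_char_seq [simp]: "apply_bcontfun (char_seq A) = indicator A"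
  unfolding char_seq_def
  by (rule Bcontfun_inverse, rule bcontfun_normI[where b = 1]) (auto simp: indicator_def)

definition SL :: "nat set set \<Rightarrow> (linf \<Rightarrow> real) set" where
  "SL I = {f. linear f \<and>
     (\<forall>x. (\<forall>n. 0 \<le> apply_bcontfun x n) \<longrightarrow> 0 \<le> f x) \<and>
     (\<forall>x. convergent (apply_bcontfun x) \<longrightarrow> f x = lim (apply_bcontfun x)) \<and>
     (\<forall>A\<in>I. f (char_seq A) = 0)}"

text \<open>Elements of \<^const>\<open>SL\<close> are automatically continuous, so \<^const>\<open>onorm\<close> of a difference
  of two of them is its genuine dual norm.\<close>

lemma SL_bounded_linear:
  assumes "f \<in> SL I"
  shows "bounded_linear f"
proof -
  have lin: "linear f"
    and pos: "\<And>x. (\<And>n. 0 \<le> apply_bcontfun x n) \<Longrightarrow> 0 \<le> f x"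
    and lim: "\<And>x. convergent (apply_bcontfun x) \<Longrightarrow> f x = lim (apply_bcontfun x)"
    using assms by (auto simp: SL_def)
  have const: "f (const_bcontfun c) = c" for c
  proof -
    have "apply_bcontfun (const_bcontfun c :: linf) = (\<lambda>_. c)"
      by (simp add: const_bcontfun.rep_eq)
    then show ?thesis
      using lim[of "const_bcontfun c"] by (simp add: convergent_const)
  qed
  have "\<bar>f x\<bar> \<le> norm x * 1" for x
  proof -
    have nx: "\<bar>apply_bcontfun x n\<bar> \<le> norm x" for n
      using norm_bounded[of x n] by simp
    have "0 \<le> f (const_bcontfun (norm x) - x)"
    proof (rule pos)
      fix n show "0 \<le> apply_bcontfun (const_bcontfun (norm x) - x) n"
        using nx[of n] by (simp add: minus_bcontfun.rep_eq const_bcontfun.rep_eq)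
    qed
    moreover have "0 \<le> f (const_bcontfun (norm x) + x)"
    proof (rule pos)
      fix n show "0 \<le> apply_bcontfun (const_bcontfun (norm x) + x) n"
        using nx[of n] by (simp add: plus_bcontfun.rep_eq const_bcontfun.rep_eq)
    qed
    ultimately show ?thesis
      using const[of "norm x"] by (simp add: linear_diff[OF lin] linear_add[OF lin])
  qed
  then show ?thesis
    using lin by (auto intro!: bounded_linear_intro[of f 1] simp: linear_add linear_scale)
qed

end

theory Submission
  imports Defs
begin

text \<open>
  The functional \<open>g\<close> is chosen to live on a set that \<open>f\<close> does not see.  If \<open>A \<notin> I\<close> and
  \<open>f (char_seq A) = 0\<close>, then the sets that meet \<open>A\<close> in a member of \<open>I\<close> form an ideal that contains
  \<open>I\<close> and the complement of \<open>A\<close>.  Every ideal \<open>J\<close> has \<open>SL J \<noteq> {}\<close> (lemma \<open>SL_nonempty\<close>), so some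
  \<open>g \<in> SL I\<close> vanishes on the complement of \<open>A\<close>.  On the sequence \<open>1 - 2 * 1\<^sub>A\<close> of norm one,
  \<open>f\<close> takes the value \<open>1\<close> and \<open>g\<close> the value \<open>-1\<close>; since both functionals have norm at most one, their
  distance is exactly \<open>2\<close>.

  Meagerness provides \<open>A\<close>.  As in the Jalali-Naini--Talagrand characterisation of meager ideals,
  there are pairwise disjoint finite sets \<open>T n\<close> such that no union of infinitely many of them is in
  \<open>I\<close> (lemma \<open>meager_disjoint_finite_sets\<close>).  The map that sends \<open>S\<close> to the value of \<open>f\<close> at the
  characteristic sequence of the union of the \<open>T n\<close> with \<open>n \<in> S\<close> is a finitely additive nonnegative measure on \<open>\<nat>\<close> that vanishes on finite sets.  Such a measure
  has an infinite null set (lemma \<open>diffuse_infinite_null_set\<close>), found by repeated halving, and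
  \<open>A\<close> is the corresponding union.
\<close>

section \<open>Finite patterns avoiding a meager set\<close>

lemma open_cylinder: "open {y :: nat \<Rightarrow> bool. \<forall>i<k. y i = x i}"
proof -
  have "open ((\<lambda>y :: nat \<Rightarrow> bool. y i) -` {x i})" for i
    by (intro open_vimage continuous_on_product_coordinates) (simp add: open_discrete)
  then have "open (\<Inter>i<k. (\<lambda>y :: nat \<Rightarrow> bool. y i) -` {x i})"
    by (intro open_INT) auto
  also have "(\<Inter>i<k. (\<lambda>y :: nat \<Rightarrow> bool. y i) -` {x i}) = {y. \<forall>i<k. y i = x i}"
    by auto
  finally show ?thesis .
qed

text \<open>In the product topology only finitely many coordinates are restricted, so the coordinates
  below a common bound decide.\<close>

lemma open_contains_cylinder:
  fixes x :: "nat \<Rightarrow> bool"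
  assumes "open U" "x \<in> U"
  obtains m where "\<forall>y. (\<forall>i<m. y i = x i) \<longrightarrow> y \<in> U"
proof -
  obtain X where X: "x \<in> (\<Pi>\<^sub>E i\<in>UNIV. X i)" "finite {i. X i \<noteq> UNIV}" "(\<Pi>\<^sub>E i\<in>UNIV. X i) \<subseteq> U"
    using product_topology_open_contains_basis[of "\<lambda>i. euclidean" UNIV U x] assms
    unfolding open_fun_def by auto
  obtain m where m: "\<And>i. X i \<noteq> UNIV \<Longrightarrow> i < m"
    using X(2) unfolding finite_nat_set_iff_bounded by auto
  have "y \<in> U" if y: "\<forall>i<m. y i = x i" for y
  proof -
    have "y i \<in> X i" for i
      using y m[of i] X(1) by (cases "X i = UNIV") (auto simp: PiE_iff)
    then have "y \<in> (\<Pi>\<^sub>E i\<in>UNIV. X i)"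
      by (simp add: PiE_iff)
    then show ?thesis
      using X(3) by (rule subsetD[rotated])
  qed
  then show thesis
    using that[of m] by blast
qed

lemma nowhere_dense_avoid:
  assumes "nowhere_dense N"
  obtains m D where "k \<le> m" "D \<inter> {..<k} = C \<inter> {..<k}"
    "\<forall>B. B \<inter> {..<m} = D \<inter> {..<m} \<longrightarrow> char_fun B \<notin> N"
proof -
  define U where "U = {y. \<forall>i<k. y i = char_fun C i}"
  have "open U"
    unfolding U_def by (rule open_cylinder)
  moreover have "char_fun C \<in> U"
    by (simp add: U_def)
  ultimately have "\<not> U \<subseteq> closure N"
    using assms interior_maximal[of U "closure N"] unfolding nowhere_dense_def by blast
  then obtain x where x: "x \<in> U" "x \<in> - closure N"
    by blast
  obtain m where m: "\<forall>y. (\<forall>i<m. y i = x i) \<longrightarrow> y \<in> - closure N"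
    by (rule open_contains_cylinder[OF open_Compl[OF closed_closure] x(2)]) (rule that)
  show thesis
  proof
    show "k \<le> max k m" by simp
    show "{i. x i} \<inter> {..<k} = C \<inter> {..<k}"
      using x(1) by (auto simp: U_def char_fun_def)
    show "\<forall>B. B \<inter> {..<max k m} = {i. x i} \<inter> {..<max k m} \<longrightarrow> char_fun B \<notin> N"
    proof (intro allI impI)
      fix B assume B: "B \<inter> {..<max k m} = {i. x i} \<inter> {..<max k m}"
      have "char_fun B i = x i" if "i < m" for i
        using eqset_imp_iff[OF B, of i] that by (simp add: char_fun_def less_max_iff_disj)
      then have "char_fun B \<in> - closure N"
        using m by simp
      then show "char_fun B \<notin> N"
        using closure_subset[of N] by blast
    qed
  qed
qed

text \<open>A pair \<open>(P, N)\<close> asks the sets that begin like \<open>P\<close> to stay out of \<open>N\<close>.  The pattern is extended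
  once for each pair in \<open>Q\<close>: extending it further keeps what has already been avoided, and a nowhere dense set can be avoided after any finite beginning.\<close>

lemma pattern_avoiding_finitely_many:
  assumes "finite Q" "\<And>P N. (P, N) \<in> Q \<Longrightarrow> nowhere_dense N"
  shows "\<exists>m\<ge>k. \<exists>T\<subseteq>{k..<m}. \<forall>P N B. (P, N) \<in> Q \<longrightarrow>
           B \<inter> {..<k} = P \<inter> {..<k} \<longrightarrow> B \<inter> {k..<m} = T \<longrightarrow> char_fun B \<notin> N"
  using assms
proof (induction Q)
  case empty
  show ?case by (intro exI[of _ k] conjI exI[of _ "{}"]) simp_all
next
  case (insert q Q)
  obtain P N where q: "q = (P, N)" by force
  have "\<exists>m\<ge>k. \<exists>T\<subseteq>{k..<m}. \<forall>P N B. (P, N) \<in> Q \<longrightarrow>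
      B \<inter> {..<k} = P \<inter> {..<k} \<longrightarrow> B \<inter> {k..<m} = T \<longrightarrow> char_fun B \<notin> N"
    by (rule insert.IH) (rule insert.prems, rule insertI2)
  then obtain m T where mT: "k \<le> m" "T \<subseteq> {k..<m}" "\<forall>P N B. (P, N) \<in> Q \<longrightarrow>
      B \<inter> {..<k} = P \<inter> {..<k} \<longrightarrow> B \<inter> {k..<m} = T \<longrightarrow> char_fun B \<notin> N"
    by (elim exE conjE) (rule that)
  have "nowhere_dense N"
    using insert.prems[of P N] q by simp
  then obtain m' D where D: "m \<le> m'" "D \<inter> {..<m} = ((P \<inter> {..<k}) \<union> T) \<inter> {..<m}"
    "\<forall>B. B \<inter> {..<m'} = D \<inter> {..<m'} \<longrightarrow> char_fun B \<notin> N"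
    by (rule nowhere_dense_avoid[where k = m and C = "(P \<inter> {..<k}) \<union> T"]) (rule that)
  have T_range: "k \<le> i \<and> i < m" if "i \<in> T" for i
    using subsetD[OF mT(2) that] by simp
  have D_iff: "i \<in> D \<longleftrightarrow> i \<in> P \<and> i < k \<or> i \<in> T" if "i < m" for i
    using eqset_imp_iff[OF D(2), of i] that by auto
  have D_low: "i \<in> D \<longleftrightarrow> i \<in> P" if "i < k" for i
    using D_iff[of i] T_range[of i] mT(1) that by auto
  have D_mid: "i \<in> D \<longleftrightarrow> i \<in> T" if "k \<le> i" "i < m" for i
    using D_iff[of i] that by auto
  have key: "char_fun B \<notin> N'"
    if PN: "(P', N') \<in> insert q Q" and low: "B \<inter> {..<k} = P' \<inter> {..<k}"
      and high: "B \<inter> {k..<m'} = D \<inter> {k..<m'}" for P' N' B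
  proof -
    have h: "i \<in> B \<longleftrightarrow> i \<in> D" if "k \<le> i" "i < m'" for i
      using eqset_imp_iff[OF high, of i] that by auto
    show ?thesis
    proof (cases "(P', N') \<in> Q")
      case True
      have "B \<inter> {k..<m} = T"
      proof (rule set_eqI)
        fix i show "i \<in> B \<inter> {k..<m} \<longleftrightarrow> i \<in> T"
          using h[of i] D_mid[of i] T_range[of i] D(1) by auto
      qed
      with True low show ?thesis by (intro mT(3)[rule_format])
    next
      case False
      then have eq: "P' = P" "N' = N" using PN q by auto
      have "i \<in> B \<longleftrightarrow> i \<in> D" if "i < m'" for i
        using eqset_imp_iff[OF low, of i] that h[of i] D_low[of i] unfolding eq by (cases "i < k") auto
      then show ?thesis
        unfolding eq by (intro D(3)[rule_format]) auto
    qed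
  qed
  have "\<forall>P N B. (P, N) \<in> insert q Q \<longrightarrow>
      B \<inter> {..<k} = P \<inter> {..<k} \<longrightarrow> B \<inter> {k..<m'} = D \<inter> {k..<m'} \<longrightarrow> char_fun B \<notin> N"
    by (intro allI impI) (rule key)
  moreover have "k \<le> m'" using mT(1) D(1) by (rule order_trans)
  ultimately show ?case
    by (intro exI[of _ m'] conjI exI[of _ "D \<inter> {k..<m'}"] Int_lower2)
qed

text \<open>All beginnings below \<open>k\<close> are treated at once, so that the pattern on the block alone suffices.\<close>

lemma block_pattern_avoiding:
  assumes "\<And>i. nowhere_dense (N i)"
  shows "\<exists>m\<ge>k. \<exists>T\<subseteq>{k..<m}. \<forall>i\<le>n::nat. \<forall>B. B \<inter> {k..<m} = T \<longrightarrow> char_fun B \<notin> N i"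
proof -
  have "finite (Pow {..<k} \<times> N ` {..n})"
    by simp
  moreover have "nowhere_dense M" if "(P, M) \<in> Pow {..<k} \<times> N ` {..n}" for P M
    using that by (elim SigmaE2 imageE) (simp add: assms)
  ultimately have "\<exists>m\<ge>k. \<exists>T\<subseteq>{k..<m}. \<forall>P M B. (P, M) \<in> Pow {..<k} \<times> N ` {..n} \<longrightarrow>
      B \<inter> {..<k} = P \<inter> {..<k} \<longrightarrow> B \<inter> {k..<m} = T \<longrightarrow> char_fun B \<notin> M"
    by (rule pattern_avoiding_finitely_many)
  then obtain m T where "k \<le> m" "T \<subseteq> {k..<m}" and T: "\<forall>P M B. (P, M) \<in> Pow {..<k} \<times> N ` {..n} \<longrightarrow>
      B \<inter> {..<k} = P \<inter> {..<k} \<longrightarrow> B \<inter> {k..<m} = T \<longrightarrow> char_fun B \<notin> M"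
    by (elim exE conjE) (rule that)
  moreover have "\<forall>i\<le>n. \<forall>B. B \<inter> {k..<m} = T \<longrightarrow> char_fun B \<notin> N i"
  proof (intro allI impI)
    fix i B assume "i \<le> n" and B: "B \<inter> {k..<m} = T"
    then have "(B \<inter> {..<k}, N i) \<in> Pow {..<k} \<times> N ` {..n}"
      by (intro SigmaI imageI PowI Int_lower2) simp
    then show "char_fun B \<notin> N i"
      by (rule T[rule_format]) (simp_all add: B)
  qed
  ultimately show ?thesis
    by (intro exI[of _ m] conjI exI[of _ T])
qed

text \<open>The sets \<open>T n\<close> are patterns on consecutive blocks, and \<open>T n\<close> avoids the sets with index at
  most \<open>n\<close> among countably many nowhere dense sets covering the family.  A union of infinitely
  many \<open>T n\<close> shows infinitely many of the patterns exactly, hence avoids every one of these sets.\<close>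

lemma meager_disjoint_finite_sets:
  assumes "meager (char_fun ` I)"
  obtains T :: "nat \<Rightarrow> nat set" where "\<forall>n. finite (T n)" "disjoint_family T"
    "\<forall>S. infinite S \<longrightarrow> (\<Union>n\<in>S. T n) \<notin> I"
proof -
  obtain N :: "nat \<Rightarrow> (nat \<Rightarrow> bool) set"
    where N: "\<And>n. nowhere_dense (N n)" "char_fun ` I \<subseteq> (\<Union>n. N n)"
    using assms unfolding meager_def by blast
  obtain m P where mP: "\<And>k n. k \<le> m k n" "\<And>k n. P k n \<subseteq> {k..<m k n}"
    "\<And>k n i B. \<lbrakk>i \<le> n; B \<inter> {k..<m k n} = P k n\<rbrakk> \<Longrightarrow> char_fun B \<notin> N i"
    using block_pattern_avoiding[of N, OF N(1)] by metis
  define k where "k = rec_nat 0 (\<lambda>n j. m j n)"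
  define T where "T n = P (k n) n" for n
  have k_Suc: "k (Suc n) = m (k n) n" for n
    by (simp add: k_def)
  have "mono k"
    by (rule mono_iff_le_Suc[THEN iffD2]) (simp add: k_Suc mP(1))
  have T_sub: "T n \<subseteq> {k n..<k (Suc n)}" for n
    unfolding T_def k_Suc by (rule mP(2))
  have T_off: "T j \<inter> {k n..<k (Suc n)} = {}" if "j \<noteq> n" for j n
  proof (cases "j < n")
    case True
    then have "k (Suc j) \<le> k n" by (intro monoD[OF \<open>mono k\<close>]) simp
    then have "{k j..<k (Suc j)} \<inter> {k n..<k (Suc n)} = {}" by auto
    then show ?thesis using T_sub[of j] by blast
  next
    case False
    then have "k (Suc n) \<le> k j" using that by (intro monoD[OF \<open>mono k\<close>]) simp
    then have "{k j..<k (Suc j)} \<inter> {k n..<k (Suc n)} = {}" by auto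
    then show ?thesis using T_sub[of j] by blast
  qed
  show thesis
  proof
    show "\<forall>n. finite (T n)"
      using finite_subset[OF T_sub] by simp
    show "disjoint_family T"
      unfolding disjoint_family_on_def using T_sub T_off by blast
    show "\<forall>S. infinite S \<longrightarrow> (\<Union>n\<in>S. T n) \<notin> I"
    proof (intro allI impI notI)
      fix S :: "nat set"
      assume "infinite S" and "(\<Union>n\<in>S. T n) \<in> I"
      then obtain i where i: "char_fun (\<Union>n\<in>S. T n) \<in> N i"
        using N(2) by blast
      obtain n where n: "n \<in> S" "i \<le> n"
        using \<open>infinite S\<close> infinite_nat_iff_unbounded_le by blast
      have "(\<Union>n\<in>S. T n) \<inter> {k n..<k (Suc n)} = T n"
      proof (intro equalityI subsetI)
        fix y assume "y \<in> (\<Union>n\<in>S. T n) \<inter> {k n..<k (Suc n)}"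
        then obtain j where "y \<in> T j" "y \<in> {k n..<k (Suc n)}" by blast
        then show "y \<in> T n" using T_off[of j n] by (cases "j = n") auto
      qed (use n(1) T_sub[of n] in auto)
      then show False
        using i mP(3)[OF n(2)] unfolding k_Suc by (simp add: T_def)
    qed
  qed
qed

section \<open>An infinite null set by halving\<close>

text \<open>Passing from modulus \<open>2 ^ n\<close> to \<open>2 ^ Suc n\<close> reveals one more binary digit, whose two values
  split each residue class into two.\<close>

lemma mod_power_of_two_Suc_eq_iff:
  fixes a b :: nat
  shows "a mod 2 ^ Suc n = b mod 2 ^ Suc n \<longleftrightarrow>
    a mod 2 ^ n = b mod 2 ^ n \<and> (even (a div 2 ^ n) \<longleftrightarrow> even (b div 2 ^ n))"
proof -
  have split: "j mod 2 ^ Suc n = 2 ^ n * (j div 2 ^ n mod 2) + j mod 2 ^ n" for j :: nat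
    by (simp only: power_Suc2 mod_mult2_eq)
  have low: "j mod 2 ^ Suc n mod 2 ^ n = j mod 2 ^ n" for j :: nat
    unfolding split by simp
  have high: "j mod 2 ^ Suc n div 2 ^ n = j div 2 ^ n mod 2" for j :: nat
    unfolding split by simp
  show ?thesis
  proof
    assume *: "a mod 2 ^ Suc n = b mod 2 ^ Suc n"
    have "a mod 2 ^ n = b mod 2 ^ n"
      using low[of a] low[of b] unfolding * by (rule trans[OF sym])
    moreover have "a div 2 ^ n mod 2 = b div 2 ^ n mod 2"
      using high[of a] high[of b] unfolding * by (rule trans[OF sym])
    ultimately show "a mod 2 ^ n = b mod 2 ^ n \<and> (even (a div 2 ^ n) \<longleftrightarrow> even (b div 2 ^ n))"
      by (simp add: even_iff_mod_2_eq_zero)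
  next
    assume "a mod 2 ^ n = b mod 2 ^ n \<and> (even (a div 2 ^ n) \<longleftrightarrow> even (b div 2 ^ n))"
    then show "a mod 2 ^ Suc n = b mod 2 ^ Suc n"
      unfolding split by (simp add: mod_2_eq_odd)
  qed
qed

lemma residue_class_halves:
  fixes a :: nat
  shows "{j. j mod 2 ^ n = a mod 2 ^ n} =
      {j. j mod 2 ^ Suc n = a mod 2 ^ Suc n} \<union> {j. j mod 2 ^ Suc n = (a + 2 ^ n) mod 2 ^ Suc n}"
    and "{j. j mod 2 ^ Suc n = a mod 2 ^ Suc n} \<inter>
      {j. j mod 2 ^ Suc n = (a + 2 ^ n) mod 2 ^ Suc n} = {}"
proof -
  have "(a + 2 ^ n) mod 2 ^ n = a mod 2 ^ n" "(a + 2 ^ n) div 2 ^ n = Suc (a div 2 ^ n)"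
    by simp_all
  note iff = mod_power_of_two_Suc_eq_iff[of _ n a] mod_power_of_two_Suc_eq_iff[of _ n "a + 2 ^ n"] this
  show "{j. j mod 2 ^ n = a mod 2 ^ n} =
      {j. j mod 2 ^ Suc n = a mod 2 ^ Suc n} \<union> {j. j mod 2 ^ Suc n = (a + 2 ^ n) mod 2 ^ Suc n}"
    unfolding iff even_Suc by blast
  show "{j. j mod 2 ^ Suc n = a mod 2 ^ Suc n} \<inter>
      {j. j mod 2 ^ Suc n = (a + 2 ^ n) mod 2 ^ Suc n} = {}"
    unfolding iff even_Suc by blast
qed

text \<open>Halving the measure through residue classes modulo powers of two gives a decreasing sequence
  of sets whose measures tend to zero; an infinite set that is almost contained in each of them is
  null because finite sets are.\<close>

lemma diffuse_infinite_null_set: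
  fixes \<mu> :: "nat set \<Rightarrow> real"
  assumes nonneg: "\<And>S. 0 \<le> \<mu> S"
    and add: "\<And>S S'. S \<inter> S' = {} \<Longrightarrow> \<mu> (S \<union> S') = \<mu> S + \<mu> S'"
    and fin: "\<And>S. finite S \<Longrightarrow> \<mu> S = 0"
  obtains S where "infinite S" "\<mu> S = 0"
proof -
  define C where "C n a = {j. j mod 2 ^ n = a mod (2::nat) ^ n}" for n a
  have halves: "C n a = C (Suc n) a \<union> C (Suc n) (a + 2 ^ n)"
    "C (Suc n) a \<inter> C (Suc n) (a + 2 ^ n) = {}" for n a
    unfolding C_def by (rule residue_class_halves)+
  have mono: "\<mu> S \<le> \<mu> S'" if "S \<subseteq> S'" for S S'
  proof -
    have "\<mu> (S \<union> (S' - S)) = \<mu> S + \<mu> (S' - S)" by (rule add) auto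
    moreover have "S \<union> (S' - S) = S'" using that by auto
    ultimately show ?thesis using nonneg[of "S' - S"] by simp
  qed
  have "\<exists>b. C (Suc n) b \<subseteq> C n a \<and> \<mu> (C (Suc n) b) \<le> \<mu> (C n a) / 2" for n a
  proof -
    have sum: "\<mu> (C n a) = \<mu> (C (Suc n) a) + \<mu> (C (Suc n) (a + 2 ^ n))"
      by (subst halves(1)) (rule add[OF halves(2)])
    have sub: "C (Suc n) a \<subseteq> C n a" "C (Suc n) (a + 2 ^ n) \<subseteq> C n a"
      using equalityD2[OF halves(1)[of n a]] by blast+
    show ?thesis
    proof (cases "\<mu> (C (Suc n) a) \<le> \<mu> (C (Suc n) (a + 2 ^ n))")
      case True
      then have "\<mu> (C (Suc n) a) \<le> \<mu> (C n a) / 2" using sum by linarith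
      with sub(1) show ?thesis by (intro exI[of _ a] conjI)
    next
      case False
      then have "\<mu> (C (Suc n) (a + 2 ^ n)) \<le> \<mu> (C n a) / 2" using sum by linarith
      with sub(2) show ?thesis by (intro exI[of _ "a + 2 ^ n"] conjI)
    qed
  qed
  then obtain s where s: "\<And>n a. C (Suc n) (s n a) \<subseteq> C n a"
    "\<And>n a. \<mu> (C (Suc n) (s n a)) \<le> \<mu> (C n a) / 2"
    by metis
  define a where "a = rec_nat 0 (\<lambda>n b. s n b)"
  define D where "D n = C n (a n)" for n
  have D_Suc: "D (Suc n) \<subseteq> D n" "\<mu> (D (Suc n)) \<le> \<mu> (D n) / 2" for n
    using s[of n "a n"] by (simp_all add: D_def a_def)
  have D_small: "\<mu> (D n) \<le> \<mu> (D 0) * (1 / 2) ^ n" for n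
  proof (induction n)
    case (Suc n)
    then show ?case using D_Suc(2)[of n] by simp
  qed simp
  have D_anti: "D n \<subseteq> D m" if "m \<le> n" for m n
    using that D_Suc(1) by (rule lift_Suc_antimono_le[rotated])
  \<comment> \<open>The multiple of \<open>2 ^ n\<close> moves the chosen point of \<open>D n\<close> beyond \<open>n\<close>.\<close>
  define t where "t n = a n + 2 ^ n * n" for n
  have t_D: "t n \<in> D n" for n
    by (simp add: t_def D_def C_def)
  have t_ge: "n \<le> t n" for n
    by (simp add: t_def trans_le_add2)
  show thesis
  proof
    show "infinite (range t)"
      unfolding infinite_nat_iff_unbounded_le using t_ge by blast
    have "\<mu> (range t) \<le> \<mu> (D 0) * (1 / 2) ^ n" for n
    proof -
      have "range t \<subseteq> t ` {..<n} \<union> (D n - t ` {..<n})"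
      proof
        fix y assume "y \<in> range t"
        then obtain j where "y = t j" by auto
        then show "y \<in> t ` {..<n} \<union> (D n - t ` {..<n})"
          using t_D[of j] D_anti[of n j] by (cases "j < n") auto
      qed
      then have "\<mu> (range t) \<le> \<mu> (t ` {..<n} \<union> (D n - t ` {..<n}))"
        by (rule mono)
      also have "\<dots> = \<mu> (D n - t ` {..<n})"
        by (subst add) (auto simp: fin)
      also have "\<dots> \<le> \<mu> (D n)"
        by (rule mono) auto
      finally show ?thesis using D_small[of n] by linarith
    qed
    moreover have "(\<lambda>n. \<mu> (D 0) * (1 / 2) ^ n) \<longlonglongrightarrow> \<mu> (D 0) * 0"
      by (intro tendsto_intros LIMSEQ_power_zero) simp
    ultimately have "\<mu> (range t) \<le> 0"
      by (intro LIMSEQ_le_const) auto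
    then show "\<mu> (range t) = 0"
      using nonneg[of "range t"] by simp
  qed
qed

section \<open>Positive functionals extending a limit along a filter\<close>

text \<open>The evaluations at the points of \<open>\<nat>\<close> lie in a product of compact intervals, so they have a
  cluster point along \<open>F\<close>.  Linearity, positivity and being within \<open>e\<close> of the right limit are
  closed conditions on a functional, and each is satisfied by the evaluations, eventually along \<open>F\<close>.\<close>

lemma positive_functional_along_filter:
  fixes F :: "nat filter"
  assumes "F \<noteq> bot"
  obtains g :: "linf \<Rightarrow> real" where "linear g"
    "\<And>x. (\<And>n. 0 \<le> apply_bcontfun x n) \<Longrightarrow> 0 \<le> g x"
    "\<And>x L. (apply_bcontfun x \<longlongrightarrow> L) F \<Longrightarrow> g x = L"
proof -
  define K where "K = (\<Pi>\<^sub>E x\<in>(UNIV :: linf set). {- norm x..norm x})"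
  define \<delta> where "\<delta> n = (\<lambda>x :: linf. apply_bcontfun x n)" for n
  have "compactin (product_topology (\<lambda>x. euclidean) UNIV) K"
    unfolding K_def compactin_PiE by simp
  then have K: "compact K"
    by (simp add: euclidean_product_topology)
  have "\<delta> n \<in> K" for n
  proof -
    have "\<bar>apply_bcontfun x n\<bar> \<le> norm x" for x :: linf
      using norm_bounded[of x n] by simp
    then show ?thesis
      by (simp add: K_def \<delta>_def PiE_iff abs_le_iff minus_le_iff)
  qed
  then have "eventually (\<lambda>h. h \<in> K) (filtermap \<delta> F)"
    by (simp add: eventually_filtermap)
  moreover have "filtermap \<delta> F \<noteq> bot"
    using assms by (simp add: filtermap_bot_iff)
  ultimately obtain g where g: "inf (nhds g) (filtermap \<delta> F) \<noteq> bot"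
    using K unfolding compact_filter by blast
  have closed_cond: "Z g" if "closed {h. Z h}" "eventually (\<lambda>n. Z (\<delta> n)) F" for Z
  proof (rule ccontr)
    assume "\<not> Z g"
    have "open (- {h. Z h})"
      using that(1) by (simp add: open_Compl)
    then have "eventually (\<lambda>h. h \<in> - {h. Z h}) (nhds g)"
      using \<open>\<not> Z g\<close> by (intro eventually_nhds_in_open) auto
    moreover have "eventually Z (filtermap \<delta> F)"
      using that(2) by (simp add: eventually_filtermap)
    ultimately have "eventually (\<lambda>_. False) (inf (nhds g) (filtermap \<delta> F))"
      unfolding eventually_inf
      by (intro exI[of _ "\<lambda>h. h \<in> - {h. Z h}"] exI[of _ Z]) simp
    with g show False by (simp add: eventually_False)
  qed
  show thesis
  proof
    show "linear g"
    proof (rule linearI)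
      show "g (x + y) = g x + g y" for x y
        by (rule closed_cond[of "\<lambda>h. h (x + y) = h x + h y"])
          (intro closed_Collect_eq continuous_intros continuous_on_product_coordinates, simp_all add: \<delta>_def)
      show "g (c *\<^sub>R x) = c *\<^sub>R g x" for c x
        by (rule closed_cond[of "\<lambda>h. h (c *\<^sub>R x) = c *\<^sub>R h x"])
          (intro closed_Collect_eq continuous_intros continuous_on_product_coordinates, simp_all add: \<delta>_def)
    qed
    show "0 \<le> g x" if "\<And>n. 0 \<le> apply_bcontfun x n" for x
      by (rule closed_cond[of "\<lambda>h. 0 \<le> h x"])
        (intro closed_Collect_le continuous_intros continuous_on_product_coordinates, simp_all add: \<delta>_def that)
    show "g x = L" if "(apply_bcontfun x \<longlongrightarrow> L) F" for x L
    proof -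
      have "\<bar>g x - L\<bar> \<le> e" if "0 < e" for e
      proof (rule closed_cond[of "\<lambda>h. \<bar>h x - L\<bar> \<le> e"])
        show "closed {h :: linf \<Rightarrow> real. \<bar>h x - L\<bar> \<le> e}"
          by (intro closed_Collect_le continuous_intros continuous_on_product_coordinates)
        show "eventually (\<lambda>n. \<bar>\<delta> n x - L\<bar> \<le> e) F"
          using tendstoD[OF \<open>(apply_bcontfun x \<longlongrightarrow> L) F\<close> that]
          by eventually_elim (auto simp: \<delta>_def dist_real_def)
      qed
      then have "\<bar>g x - L\<bar> \<le> 0"
        by (rule field_le_epsilon) simp
      then show ?thesis by simp
    qed
  qed
qed

text \<open>The complements of the members of \<open>J\<close> form a proper filter finer than the cofinite one.\<close>

lemma SL_nonempty:
  assumes J: "ideal_on_nat J"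
  obtains g where "g \<in> SL J"
proof -
  have un: "\<And>A B. \<lbrakk>A \<in> J; B \<in> J\<rbrakk> \<Longrightarrow> A \<union> B \<in> J" and sub: "\<And>A B. \<lbrakk>A \<in> J; B \<subseteq> A\<rbrakk> \<Longrightarrow> B \<in> J"
    and proper: "UNIV \<notin> J" and fin: "\<And>A. finite A \<Longrightarrow> A \<in> J"
    using J unfolding ideal_on_nat_def by blast+
  define F where "F = Abs_filter (\<lambda>P. {n. \<not> P n} \<in> J)"
  have "is_filter (\<lambda>P. {n. \<not> P n} \<in> J)"
  proof
    show "{n. \<not> True} \<in> J" by (simp add: fin)
    show "{n. \<not> (P n \<and> Q n)} \<in> J" if "{n. \<not> P n} \<in> J" "{n. \<not> Q n} \<in> J" for P Q
      using un[OF that] by (rule sub) auto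
    show "{n. \<not> Q n} \<in> J" if "\<forall>x. P x \<longrightarrow> Q x" "{n. \<not> P n} \<in> J" for P Q
      using that(2) by (rule sub) (use that(1) in auto)
  qed
  then have ev: "eventually P F \<longleftrightarrow> {n. \<not> P n} \<in> J" for P
    unfolding F_def by (rule eventually_Abs_filter)
  have "F \<noteq> bot"
    using ev[of "\<lambda>_. False"] proper by (auto simp: trivial_limit_def)
  then obtain g :: "linf \<Rightarrow> real" where g: "linear g"
    "\<And>x. (\<And>n. 0 \<le> apply_bcontfun x n) \<Longrightarrow> 0 \<le> g x"
    "\<And>x L. (apply_bcontfun x \<longlongrightarrow> L) F \<Longrightarrow> g x = L"
    using positive_functional_along_filter[of F] by blast
  have "F \<le> sequentially"
  proof (rule filter_leI)
    fix P :: "nat \<Rightarrow> bool" assume "eventually P sequentially"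
    then obtain N where "\<forall>n\<ge>N. P n"
      unfolding eventually_sequentially by blast
    then have "{n. \<not> P n} \<subseteq> {..<N}"
      by (auto simp: not_le[symmetric])
    then show "eventually P F"
      unfolding ev by (intro fin) (rule finite_subset[OF _ finite_lessThan])
  qed
  then have "g x = lim (apply_bcontfun x)" if "convergent (apply_bcontfun x)" for x
    using that by (intro g(3)) (auto simp: convergent_LIMSEQ_iff intro: tendsto_mono)
  moreover have "g (char_seq A) = 0" if "A \<in> J" for A
    by (intro g(3) tendsto_eventually) (simp add: ev indicator_def that)
  ultimately have "g \<in> SL J"
    using g(1,2) by (simp add: SL_def)
  then show thesis by (rule that)
qed

section \<open>Two functionals at distance two\<close>

lemma SL_linear: "f \<in> SL I \<Longrightarrow> linear f"
  by (simp add: SL_def)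

lemma SL_nonneg: "f \<in> SL I \<Longrightarrow> (\<And>n. 0 \<le> apply_bcontfun x n) \<Longrightarrow> 0 \<le> f x"
  by (simp add: SL_def)

lemma SL_null: "f \<in> SL I \<Longrightarrow> A \<in> I \<Longrightarrow> f (char_seq A) = 0"
  by (simp add: SL_def)

lemma SL_const:
  assumes "f \<in> SL I"
  shows "f (const_bcontfun c) = c"
proof -
  have "apply_bcontfun (const_bcontfun c :: linf) = (\<lambda>_. c)"
    by (simp add: const_bcontfun.rep_eq)
  then show ?thesis
    using assms by (simp add: SL_def convergent_const)
qed

lemma SL_mono:
  assumes "f \<in> SL I" "\<And>n. apply_bcontfun x n \<le> apply_bcontfun y n"
  shows "f x \<le> f y"
proof -
  have "0 \<le> f (y - x)"
    using assms(2) by (intro SL_nonneg[OF assms(1)]) (simp add: minus_bcontfun.rep_eq)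
  then show ?thesis
    by (simp add: linear_diff[OF SL_linear[OF assms(1)]])
qed

lemma SL_abs_le_norm:
  assumes "f \<in> SL I"
  shows "\<bar>f x\<bar> \<le> norm x"
proof -
  have nx: "\<bar>apply_bcontfun x n\<bar> \<le> norm x" for n
    using norm_bounded[of x n] by simp
  have "f x \<le> f (const_bcontfun (norm x))" "f (const_bcontfun (- norm x)) \<le> f x"
    using nx by (intro SL_mono[OF assms]; simp add: const_bcontfun.rep_eq abs_le_iff minus_le_iff)+
  then show ?thesis
    by (simp add: SL_const[OF assms])
qed

text \<open>The set \<open>A\<close> carries \<open>g\<close> and is null for \<open>f\<close>, so that \<open>f\<close> and \<open>g\<close> attain their norms with
  opposite signs at \<open>1 - 2 * 1\<^sub>A\<close>.\<close>

lemma SL_distance_two: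
  assumes f: "f \<in> SL I" and g: "g \<in> SL I"
    and fA: "f (char_seq A) = 0" and gA: "g (char_seq A) = 1"
  shows "onorm (\<lambda>x. f x - g x) = 2"
proof (rule antisym)
  have bound: "norm (f x - g x) \<le> 2 * norm x" for x
    using SL_abs_le_norm[OF f, of x] SL_abs_le_norm[OF g, of x] by simp
  show "onorm (\<lambda>x. f x - g x) \<le> 2"
    by (rule onorm_bound) (simp, rule bound)
  have bl: "bounded_linear (\<lambda>x. f x - g x)"
    using f g by (intro bounded_linear_sub SL_bounded_linear)
  define x where "x = const_bcontfun 1 - 2 *\<^sub>R char_seq A"
  have "norm x \<le> 1"
    unfolding x_def
    by (rule norm_bound)
      (simp add: minus_bcontfun.rep_eq scaleR_bcontfun.rep_eq const_bcontfun.rep_eq indicator_def)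
  have value_x: "h x = 1 - 2 * h (char_seq A)" if "h \<in> SL I" for h
    using SL_linear[OF that] SL_const[OF that, of 1] by (simp add: x_def linear_diff linear_scale)
  have "f x - g x = 2"
    by (simp add: value_x[OF f] value_x[OF g] fA gA)
  then have "2 \<le> onorm (\<lambda>x. f x - g x) * norm x"
    using onorm[OF bl, of x] by simp
  also have "\<dots> \<le> onorm (\<lambda>x. f x - g x) * 1"
    using \<open>norm x \<le> 1\<close> onorm_pos_le[OF bl] by (rule mult_left_mono)
  finally show "2 \<le> onorm (\<lambda>x. f x - g x)" by simp
qed

text \<open>The ideal of all sets meeting \<open>A\<close> in a member of \<open>I\<close> is proper because \<open>A \<notin> I\<close>, and it
  contains the complement of \<open>A\<close>.\<close>

lemma SL_concentrated_on:
  assumes I: "ideal_on_nat I" and "A \<notin> I"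
  obtains g where "g \<in> SL I" "g (char_seq A) = 1"
proof -
  define J where "J = {B. B \<inter> A \<in> I}"
  have un: "\<And>A B. \<lbrakk>A \<in> I; B \<in> I\<rbrakk> \<Longrightarrow> A \<union> B \<in> I" and sub: "\<And>A B. \<lbrakk>A \<in> I; B \<subseteq> A\<rbrakk> \<Longrightarrow> B \<in> I"
    and fin: "\<And>A. finite A \<Longrightarrow> A \<in> I"
    using I unfolding ideal_on_nat_def by blast+
  have "ideal_on_nat J"
    unfolding ideal_on_nat_def J_def
    using \<open>A \<notin> I\<close> by (auto simp: Int_Un_distrib2 un fin elim: sub)
  then obtain g where g: "g \<in> SL J"
    by (rule SL_nonempty)
  have "I \<subseteq> J"
    unfolding J_def by (auto elim: sub)
  then have "g \<in> SL I"
    using g by (auto simp: SL_def)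
  moreover have "g (char_seq A) = 1"
  proof -
    have "- A \<in> J"
      by (simp add: J_def fin)
    then have "g (char_seq (- A)) = 0"
      by (rule SL_null[OF g])
    moreover have "char_seq A = const_bcontfun 1 - char_seq (- A)"
      by (rule bcontfun_eqI)
        (simp add: minus_bcontfun.rep_eq const_bcontfun.rep_eq indicator_def)
    ultimately show ?thesis
      using SL_const[OF g, of 1] by (simp add: linear_diff[OF SL_linear[OF g]])
  qed
  ultimately show thesis by (rule that)
qed

lemma char_seq_Un_disjoint:
  assumes "U \<inter> V = {}"
  shows "char_seq (U \<union> V) = char_seq U + char_seq V"
proof (rule bcontfun_eqI)
  fix n
  show "apply_bcontfun (char_seq (U \<union> V)) n = apply_bcontfun (char_seq U + char_seq V) n"
    using assms by (cases "n \<in> U") (auto simp: plus_bcontfun.rep_eq indicator_def)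
qed

lemma meager_ideal_null_positive_set:
  assumes "meager_ideal I" and f: "f \<in> SL I"
  obtains A where "A \<notin> I" "f (char_seq A) = 0"
proof -
  have I: "ideal_on_nat I" and "meager (char_fun ` I)"
    using assms(1) by (simp_all add: meager_ideal_def)
  from this(2) obtain T :: "nat \<Rightarrow> nat set" where T: "\<forall>n. finite (T n)" "disjoint_family T"
    "\<forall>S. infinite S \<longrightarrow> (\<Union>n\<in>S. T n) \<notin> I"
    by (rule meager_disjoint_finite_sets)
  define \<mu> where "\<mu> S = f (char_seq (\<Union>n\<in>S. T n))" for S
  have nonneg: "0 \<le> \<mu> S" for S
    unfolding \<mu>_def by (rule SL_nonneg[OF f]) simp
  have add: "\<mu> (S \<union> S') = \<mu> S + \<mu> S'" if "S \<inter> S' = {}" for S S'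
  proof -
    have "(\<Union>n\<in>S. T n) \<inter> (\<Union>n\<in>S'. T n) = {}"
    proof (intro equals0I, elim IntE UN_E)
      fix y i j assume "i \<in> S" "j \<in> S'" "y \<in> T i" "y \<in> T j"
      moreover from this that have "T i \<inter> T j = {}"
        using T(2) by (intro disjoint_family_onD[of T UNIV]) auto
      ultimately show False by blast
    qed
    then have "char_seq (\<Union>n\<in>S \<union> S'. T n) = char_seq (\<Union>n\<in>S. T n) + char_seq (\<Union>n\<in>S'. T n)"
      by (simp only: UN_Un char_seq_Un_disjoint)
    then show ?thesis
      by (simp add: \<mu>_def linear_add[OF SL_linear[OF f]] del: UN_Un)
  qed
  have fin: "\<mu> S = 0" if "finite S" for S
  proof -
    have "(\<Union>n\<in>S. T n) \<in> I"
      using I T(1) that by (simp add: ideal_on_nat_def)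
    then show ?thesis
      unfolding \<mu>_def by (rule SL_null[OF f])
  qed
  obtain S where "infinite S" "\<mu> S = 0"
    by (rule diffuse_infinite_null_set[of \<mu>]) (rule nonneg, erule add, erule fin, rule that)
  then show thesis
    using T(3) unfolding \<mu>_def by (intro that) simp_all
qed

theorem theorem2p4:
  fixes I :: "nat set set" and f :: "linf \<Rightarrow> real"
  assumes "meager_ideal I" and "f \<in> SL I"
  shows "\<exists>g\<in>SL I. onorm (\<lambda>x. f x - g x) = 2"
proof -
  obtain A where A: "A \<notin> I" "f (char_seq A) = 0"
    using meager_ideal_null_positive_set[OF assms] .
  have "ideal_on_nat I"
    using assms(1) by (simp add: meager_ideal_def)
  then obtain g where "g \<in> SL I" "g (char_seq A) = 1"
    using A(1) by (rule SL_concentrated_on)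
  then show ?thesis
    using SL_distance_two[OF assms(2)] A(2) by blast
qed

end
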